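(* Let $R=\mathbb{R}$ or $\mathbb{C}$, let $d\ge1$, and let $q=\{q_s\}_{s\ge0}\subset R[x]_d$ satisfy $q_0(x)=x^d$, $q_{s+u}=q_s\boxplus_dq_u$ for all $s,u\ge0$, and $q_s\to x^d$ coefficientwise as $s\downarrow0$. Then for every $p\in R[x]_d$, $$\mathcal{J}_d(L[q]p)=L_H^{(d)}[\mathcal{J}_d(q)]\,\mathcal{J}_d(p),$$ where $L[q]p=\lim_{s\downarrow0}\frac{p\boxplus_dq_s-p}{s}$ (coefficientwise limit) is the generator of the semigroup $p\mapsto p\boxplus_dq_s$ on $R[x]_d$, and $L_H^{(d)}[\mathcal{J}_d(q)]$ is the generator associated with $\boxplus^H_d$ on $h_{\le d}R$, i.e. $L_H^{(d)}[\mathcal{J}_d(q)]g=\lim_{s\downarrow0}\frac{g\boxplus^H_d\mathcal{J}_d(q_s)-g}{s}$ (coefficientwise).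
   Context: $\mathbb{N}=\{0,1,2,\dots\}$. $(d)_{\underline{0}}=1$, $(d)_{\underline{n}}=d(d-1)\cdots(d-n+1)$ for $n\ge1$. $R[x]_d$ denotes the polynomials $p(x)=\sum_{k=0}^da_kx^{d-k}$ with $a_k\in R$. For $p=\sum_{k=0}^da_kx^{d-k}$ and $q=\sum_{k=0}^db_kx^{d-k}$, the finite free convolution is $$(p\boxplus_dq)(x)=\sum_{k=0}^d\sum_{i+j=k}\frac{(d)_{\underline{k}}}{(d)_{\underline{i}}(d)_{\underline{j}}}a_ib_jx^{d-k}.$$ $h_{\le d}R$ is the set of maps $f:\mathbb{N}\to R$ with $f(n)=0$ for $n>d$. For $f,g\in h_{\le d}R$, $(f\boxplus^H_dg)(n)=\sum_{i+j=n}\frac{(d)_{\underline{n}}}{(d)_{\underline{i}}(d)_{\underline{j}}}f(i)g(j)$ for $0\le n\le d$, and $(f\boxplus^H_dg)(n)=0$ for $n>d$. The map $\mathcal{J}_d:R[x]_d\to h_{\le d}R$ sends $p=\sum_{k=0}^da_kx^{d-k}$ to the map with $\mathcal{J}_d(p)(k)=a_k$ for $0\le k\le d$ (and $0$ for $k>d$). $\mathcal{J}_d(q)$ denotes the family $\{\mathcal{J}_d(q_s)\}_{s\ge0}$. *)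

theory Defs
  imports Complex_Main "HOL-Computational_Algebra.Polynomial"
begin

(* The scalars R are a type of class real_normed_field. Both real and complex are instances,
   and since the norm of this class is multiplicative, the Gelfand-Mazur theorem says that up to
   isometric isomorphism there are no others. *)

definition falling :: "nat \<Rightarrow> nat \<Rightarrow> 'a::comm_ring_1" where
  "falling d n = (\<Prod>i<n. of_nat d - of_nat i)"

definition polys_le :: "nat \<Rightarrow> 'a::zero poly set" where
  "polys_le d = {p. degree p \<le> d}"

definition maps_le :: "nat \<Rightarrow> (nat \<Rightarrow> 'a::zero) set" where
  "maps_le d = {f. \<forall>n>d. f n = 0}"

(* Coefficients are numbered from the top: the k-th coefficient of p, relative to d,
   is the one of x^(d-k). All uses have k <= d. *)

definition top_coeff :: "nat \<Rightarrow> 'a::zero poly \<Rightarrow> nat \<Rightarrow> 'a" where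
  "top_coeff d p k = coeff p (d - k)"

definition free_conv :: "nat \<Rightarrow> 'a::field poly \<Rightarrow> 'a poly \<Rightarrow> 'a poly" where
  "free_conv d p q = (\<Sum>k\<le>d. \<Sum>i\<le>k.
     monom (falling d k / (falling d i * falling d (k - i))
              * top_coeff d p i * top_coeff d q (k - i)) (d - k))"

definition H_conv :: "nat \<Rightarrow> (nat \<Rightarrow> 'a::field) \<Rightarrow> (nat \<Rightarrow> 'a) \<Rightarrow> nat \<Rightarrow> 'a" where
  "H_conv d f g n = (if n \<le> d
     then \<Sum>i\<le>n. falling d n / (falling d i * falling d (n - i)) * f i * g (n - i)
     else 0)"

definition J_map :: "nat \<Rightarrow> 'a::zero poly \<Rightarrow> nat \<Rightarrow> 'a" where
  "J_map d p k = (if k \<le> d then top_coeff d p k else 0)"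

definition poly_tendsto ::
  "('b \<Rightarrow> 'a::{zero, topological_space} poly) \<Rightarrow> 'a poly \<Rightarrow> 'b filter \<Rightarrow> bool" where
  "poly_tendsto P l F \<longleftrightarrow> (\<forall>n. ((\<lambda>s. coeff (P s) n) \<longlongrightarrow> coeff l n) F)"

definition map_tendsto ::
  "('b \<Rightarrow> nat \<Rightarrow> 'a::topological_space) \<Rightarrow> (nat \<Rightarrow> 'a) \<Rightarrow> 'b filter \<Rightarrow> bool" where
  "map_tendsto f l F \<longleftrightarrow> (\<forall>n. ((\<lambda>s. f s n) \<longlongrightarrow> l n) F)"

(* A family indexed by s >= 0 is a function on all reals; its values at s < 0 are never used. *)

definition free_quot ::
  "nat \<Rightarrow> (real \<Rightarrow> 'a::real_normed_field poly) \<Rightarrow> 'a poly \<Rightarrow> real \<Rightarrow> 'a poly" where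
  "free_quot d q p s = smult (1 / of_real s) (free_conv d p (q s) - p)"

definition H_quot ::
  "nat \<Rightarrow> (real \<Rightarrow> nat \<Rightarrow> 'a::real_normed_field) \<Rightarrow> (nat \<Rightarrow> 'a) \<Rightarrow> real \<Rightarrow> nat \<Rightarrow> 'a" where
  "H_quot d r g s n = (H_conv d g (r s) n - g n) / of_real s"

(* The generators are meaningful only where the limits exist. *)

definition free_generator ::
  "nat \<Rightarrow> (real \<Rightarrow> 'a::real_normed_field poly) \<Rightarrow> 'a poly \<Rightarrow> 'a poly" where
  "free_generator d q p = (THE l. poly_tendsto (free_quot d q p) l (at_right 0))"

definition H_generator ::
  "nat \<Rightarrow> (real \<Rightarrow> nat \<Rightarrow> 'a::real_normed_field) \<Rightarrow> (nat \<Rightarrow> 'a) \<Rightarrow> nat \<Rightarrow> 'a" where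
  "H_generator d r g = (THE l. map_tendsto (H_quot d r g) l (at_right 0))"

lemma free_generator_eqI:
  assumes "poly_tendsto (free_quot d q p) l (at_right 0)"
  shows "free_generator d q p = l"
  unfolding free_generator_def
proof (rule the_equality, fact assms)
  fix l' assume "poly_tendsto (free_quot d q p) l' (at_right 0)"
  with assms show "l' = l"
    unfolding poly_tendsto_def
    by (intro poly_eqI) (metis tendsto_unique trivial_limit_at_right_real)
qed

lemma H_generator_eqI:
  assumes "map_tendsto (H_quot d r g) l (at_right 0)"
  shows "H_generator d r g = l"
  unfolding H_generator_def
proof (rule the_equality, fact assms)
  fix l' assume "map_tendsto (H_quot d r g) l' (at_right 0)"
  with assms show "l' = l"
    unfolding map_tendsto_def
    by (intro ext) (metis tendsto_unique trivial_limit_at_right_real)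
qed

end

theory Submission
  imports Defs "HOL-Analysis.Analysis"
begin

(* Dividing the k-th coefficient of q_s by the k-th falling factorial of d turns both convolutions
   into the truncated Cauchy product, so the normalised coefficients form a right-continuous
   semigroup of lower triangular Toeplitz matrices. Such a semigroup is differentiable at 0, by the
   classical argument of multiplying it with its own integral over a short interval; hence both
   generators exist, and the coefficient map intertwines the difference quotients themselves.
   A real normed field is not assumed to be complete, so the integrals (here: antiderivatives) are
   obtained from an elementary form of the Gelfand-Mazur theorem. *)

section \<open>Elementary Gelfand-Mazur theorem for real normed fields\<close>

(* Squaring step: Y^4 - 2 c E^2 Y^2 + E^4 factors as (Y^2 - 2 c' E Y + E^2) (Y^2 + 2 c' E Y + E^2)
   when 2 c'^2 - 1 = c (half-angle formula). *)
lemma quadratic_norm_ge_pow2: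
  fixes y :: "'a::real_normed_field" and \<eta> m :: real
  assumes m: "m \<ge> 0"
    and base: "\<And>c. \<bar>c\<bar> \<le> 1 \<Longrightarrow> m\<^sup>2 \<le> norm (y\<^sup>2 - of_real (2 * c * \<eta>) * y + of_real (\<eta>\<^sup>2))"
    and c: "\<bar>c\<bar> \<le> 1"
  shows "m ^ (2 * 2^k) \<le> norm (y ^ (2 * 2^k) - of_real (2 * c * \<eta> ^ (2^k)) * y ^ (2^k) + of_real (\<eta> ^ (2 * 2^k)))"
  using c
proof (induction k arbitrary: c)
  case 0
  then show ?case using base[of c] by simp
next
  case (Suc k)
  define c' where "c' = sqrt ((1 + c) / 2)"
  have c'2: "2 * c'\<^sup>2 = 1 + c" and c'1: "\<bar>c'\<bar> \<le> 1"
    using Suc.prems by (auto simp: c'_def abs_le_iff)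
  define Y where "Y = y ^ (2^k)"
  define E where "E = \<eta> ^ (2^k)"
  have "m ^ (2 * 2^k) * m ^ (2 * 2^k) \<le>
      norm (Y\<^sup>2 - of_real (2 * c' * E) * Y + of_real (E\<^sup>2)) * norm (Y\<^sup>2 - of_real (2 * (- c') * E) * Y + of_real (E\<^sup>2))"
    using Suc.IH[of c'] Suc.IH[of "-c'"] c'1 m unfolding Y_def E_def
    by (intro mult_mono) (auto simp: power_mult[symmetric] mult.commute)
  also have "\<dots> = norm (Y^4 - of_real (2 * (2 * c'\<^sup>2 - 1) * E\<^sup>2) * Y\<^sup>2 + of_real (E^4))"
    unfolding norm_mult[symmetric]
    by (rule arg_cong[of _ _ norm]) (simp add: algebra_simps power2_eq_square power4_eq_xxxx)
  also have "2 * c'\<^sup>2 - 1 = c" using c'2 by simp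
  finally show ?case
    unfolding Y_def E_def by (simp add: power_mult[symmetric] power_add[symmetric] mult.commute)
qed

text \<open>Telescope \<open>y^(2^k) - \<eta>^(2^k)\<close> into \<open>y - \<eta>\<close> times the
  sums \<open>y^(2^i) + \<eta>^(2^i)\<close> with i < k, each of norm at least
  \<open>m^(2^i)\<close>. This bounds the norm by
  \<open>m * (1 + (\<bar>\<eta>\<bar> / m)^(2^k))\<close>, which tends to \<open>m\<close>.\<close>

lemma norm_diff_le_of_quadratic_norm_ge:
  fixes y :: "'a::real_normed_field" and \<eta> m :: real
  assumes m: "m > 0" "norm y = m" and \<eta>: "\<bar>\<eta>\<bar> < m"
    and base: "\<And>c. \<bar>c\<bar> \<le> 1 \<Longrightarrow> m\<^sup>2 \<le> norm (y\<^sup>2 - of_real (2 * c * \<eta>) * y + of_real (\<eta>\<^sup>2))"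
  shows "norm (y - of_real \<eta>) \<le> m"
proof -
  \<comment> \<open>At c = -1 the quadratic in \<open>y^(2^k)\<close> is a perfect square.\<close>
  have plus: "m ^ (2^k) \<le> norm (y ^ (2^k) + of_real (\<eta> ^ (2^k)))" for k
  proof -
    have "(m ^ (2^k))\<^sup>2 \<le> norm (y ^ (2 * 2^k) - of_real (2 * (-1) * \<eta> ^ (2^k)) * y ^ (2^k) + of_real (\<eta> ^ (2 * 2^k)))"
      using quadratic_norm_ge_pow2[of m y \<eta> "-1" k] base m by (simp add: power_mult[symmetric] mult.commute)
    also have "\<dots> = norm ((y ^ (2^k) + of_real (\<eta> ^ (2^k)))\<^sup>2)"
      by (rule arg_cong[of _ _ norm]) (simp add: power2_sum power_even_eq)
    also have "\<dots> = (norm (y ^ (2^k) + of_real (\<eta> ^ (2^k))))\<^sup>2" by (simp add: norm_power)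
    finally show ?thesis by (rule power2_le_imp_le) simp
  qed
  have prod: "norm (y - of_real \<eta>) * m ^ (2^k) \<le> m * norm (y ^ (2^k) - of_real (\<eta> ^ (2^k)))" for k
  proof (induction k)
    case (Suc k)
    have "norm (y - of_real \<eta>) * m ^ (2^Suc k) = (norm (y - of_real \<eta>) * m ^ (2^k)) * m ^ (2^k)"
      by (simp add: power_add[symmetric] mult_2)
    also have "\<dots> \<le> (m * norm (y ^ (2^k) - of_real (\<eta> ^ (2^k)))) * norm (y ^ (2^k) + of_real (\<eta> ^ (2^k)))"
      using m by (intro mult_mono[OF Suc plus]) auto
    also have "\<dots> = m * norm ((y ^ (2^k) - of_real (\<eta> ^ (2^k))) * (y ^ (2^k) + of_real (\<eta> ^ (2^k))))"
      by (simp add: norm_mult)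
    also have "(y ^ (2^k) - of_real (\<eta> ^ (2^k))) * (y ^ (2^k) + of_real (\<eta> ^ (2^k)))
        = y ^ (2^Suc k) - of_real (\<eta> ^ (2^Suc k))"
      by (simp add: algebra_simps power_add mult_2)
    finally show ?case .
  qed (simp add: mult.commute)
  have le: "norm (y - of_real \<eta>) \<le> m * (1 + (\<bar>\<eta>\<bar> / m) ^ (2^k))" for k
  proof -
    have "norm (y ^ (2^k) - of_real (\<eta> ^ (2^k))) \<le> m ^ (2^k) + \<bar>\<eta>\<bar> ^ (2^k)"
      using norm_triangle_ineq4[of "y ^ (2^k)" "of_real (\<eta> ^ (2^k))"] m(2)
      by (simp add: norm_power power_abs)
    then have "norm (y - of_real \<eta>) * m ^ (2^k) \<le> m * (m ^ (2^k) + \<bar>\<eta>\<bar> ^ (2^k))"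
      using prod[of k] m(1) by (meson mult_left_mono order_trans less_imp_le)
    then show ?thesis using m(1) by (simp add: field_simps power_divide)
  qed
  have "filterlim (\<lambda>k. 2^k :: nat) at_top sequentially"
    by (rule filterlim_subseq) (simp add: strict_mono_def)
  then have "(\<lambda>k. (\<bar>\<eta>\<bar> / m) ^ (2^k)) \<longlonglongrightarrow> 0"
    using \<eta> m by (intro filterlim_compose[OF LIMSEQ_power_zero]) auto
  then have "(\<lambda>k. m * (1 + (\<bar>\<eta>\<bar> / m) ^ (2^k))) \<longlonglongrightarrow> m * (1 + 0)"
    by (intro tendsto_intros)
  then show ?thesis using le by (intro LIMSEQ_le_const) auto
qed

(* Let m be the minimum of norm ((x - a)^2 + b^2). If m > 0, then increasing b^2 by m / 2 at a
   minimum point gives a minimum point again, so the norm would stay bounded for arbitrarily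
   large b. *)
lemma real_quadratic_exists:
  fixes x :: "'a::real_normed_field"
  obtains a b :: real where "(x - of_real a)\<^sup>2 + of_real (b\<^sup>2) = 0"
proof -
  \<comment> \<open>\<open>Q z\<close> is the value at \<open>x\<close> of the monic real quadratic
    with roots \<open>z\<close> and its conjugate.\<close>
  define Q where "Q z = (x - of_real (Re z))\<^sup>2 + of_real ((Im z)\<^sup>2)" for z
  define N where "N = norm x"
  have N0: "N \<ge> 0" by (simp add: N_def)
  \<comment> \<open>Outside radius \<open>3 * N\<close> the norm of \<open>Q z\<close> is at least
    \<open>N\<^sup>2\<close>, the norm of \<open>Q 0\<close>, because r^2 - 2 r N - 3 N^2 = (r + N)
    (r - 3 N). The minimum over the ball is therefore global.\<close>
  have "continuous_on (cball 0 (3 * N)) (\<lambda>z. norm (Q z))"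
    unfolding Q_def by (intro continuous_intros)
  moreover have "cball 0 (3 * N) \<noteq> ({} :: complex set)" using N0 by simp
  ultimately obtain w where w: "w \<in> cball 0 (3 * N)" "\<And>z. z \<in> cball 0 (3 * N) \<Longrightarrow> norm (Q w) \<le> norm (Q z)"
    using continuous_attains_inf[OF compact_cball] by blast
  define m where "m = norm (Q w)"
  have min: "m \<le> norm (Q z)" for z
  proof (cases "z \<in> cball 0 (3 * N)")
    case False
    define r where "r = cmod z"
    have r: "r > 3 * N" using False by (simp add: r_def)
    have eq: "of_real (r\<^sup>2) = Q z + of_real (2 * Re z) * x - x\<^sup>2"
      by (simp add: Q_def r_def cmod_power2 power2_diff algebra_simps)
    have "r\<^sup>2 = norm (of_real (r\<^sup>2) :: 'a)" by (simp only: norm_of_real) simp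
    also have "\<dots> \<le> norm (Q z) + norm (of_real (2 * Re z) * x) + norm (x\<^sup>2)"
      unfolding eq using norm_triangle_ineq4 norm_triangle_ineq by (smt (verit))
    also have "\<dots> = norm (Q z) + 2 * \<bar>Re z\<bar> * N + N\<^sup>2"
      by (simp add: norm_mult norm_power N_def)
    also have "2 * \<bar>Re z\<bar> * N \<le> 2 * r * N"
      using abs_Re_le_cmod[of z] N0 unfolding r_def by (intro mult_right_mono) auto
    finally have "r\<^sup>2 - 2 * r * N - N\<^sup>2 \<le> norm (Q z)" by simp
    moreover have "(r + N) * (r - 3 * N) \<ge> 0" using r N0 by simp
    then have "r\<^sup>2 - 2 * r * N - 3 * N\<^sup>2 \<ge> 0" by (simp add: algebra_simps power2_eq_square)
    ultimately have "N\<^sup>2 \<le> norm (Q z)"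
      using zero_le_power2[of N] by linarith
    moreover have "m \<le> norm (Q 0)" unfolding m_def using N0 by (intro w(2)) simp
    ultimately show ?thesis by (simp add: Q_def N_def norm_power)
  qed (use w in \<open>auto simp: m_def\<close>)
  have "m = 0"
  proof (rule ccontr)
    assume "m \<noteq> 0"
    then have m0: "m > 0" by (simp add: m_def)
    (* The quartic splits into two real quadratics in x, given by the complex roots of
       (t - a)^2 + b^2 = \<eta> exp (i \<theta>) with c = cos \<theta>. *)
    have quartic: "m\<^sup>2 \<le> norm ((Q z)\<^sup>2 - of_real (2 * c * \<eta>) * Q z + of_real (\<eta>\<^sup>2))"
      if "\<bar>c\<bar> \<le> 1" for z c \<eta>
    proof -
      have c2: "c\<^sup>2 \<le> 1" using that by (simp add: abs_square_le_1)
      define a b where "a = Re z" and "b = Im z"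
      \<comment> \<open>Here \<open>sqrt (1 - c\<^sup>2)\<close> is the sine of \<theta>, and the
        roots are a + u and a - u; each of the two values of \<open>Q\<close> below takes one of
        them together with its conjugate.\<close>
      define u where "u = csqrt (Complex (c * \<eta> - b\<^sup>2) (\<eta> * sqrt (1 - c\<^sup>2)))"
      define p s where "p = Re u" and "s = Im u"
      have u2: "u\<^sup>2 = Complex (c * \<eta> - b\<^sup>2) (\<eta> * sqrt (1 - c\<^sup>2))" by (simp add: u_def)
      have e1: "p\<^sup>2 - s\<^sup>2 = c * \<eta> - b\<^sup>2"
        using arg_cong[OF u2, of Re] by (simp add: p_def s_def power2_eq_square)
      have "(p\<^sup>2 + s\<^sup>2)\<^sup>2 = (cmod (u\<^sup>2))\<^sup>2" by (simp add: p_def s_def norm_power cmod_power2)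
      also have "\<dots> = (c * \<eta> - b\<^sup>2)\<^sup>2 + \<eta>\<^sup>2 * (1 - c\<^sup>2)"
        unfolding u2 using c2 by (simp add: cmod_power2 power_mult_distrib)
      also have "\<dots> = b^4 - 2 * c * \<eta> * b\<^sup>2 + \<eta>\<^sup>2" by (simp add: power2_eq_square power4_eq_xxxx algebra_simps)
      finally have e2: "(p\<^sup>2 + s\<^sup>2)\<^sup>2 = b^4 - 2 * c * \<eta> * b\<^sup>2 + \<eta>\<^sup>2" .
      define t where "t = x - of_real a"
      have "Q (Complex (a + p) s) * Q (Complex (a - p) s) =
          t^4 - of_real (2 * (p\<^sup>2 - s\<^sup>2)) * t\<^sup>2 + of_real ((p\<^sup>2 + s\<^sup>2)\<^sup>2)"
        by (simp add: Q_def t_def algebra_simps power2_eq_square power4_eq_xxxx)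
      also have "\<dots> = (Q z)\<^sup>2 - of_real (2 * c * \<eta>) * Q z + of_real (\<eta>\<^sup>2)"
        unfolding e1 e2 Q_def a_def[symmetric] b_def[symmetric] t_def[symmetric]
        by (simp add: algebra_simps power2_eq_square power4_eq_xxxx)
      finally show ?thesis
        using mult_mono[OF min[of "Complex (a + p) s"] min[of "Complex (a - p) s"]] m0
        by (simp add: norm_mult[symmetric] power2_eq_square)
    qed
    have shift: "norm (Q (Complex (Re w) (sqrt ((Im w)\<^sup>2 + real n * (m / 2))))) = m" for n
    proof (induction n)
      case (Suc n)
      let ?z = "\<lambda>n. Complex (Re w) (sqrt ((Im w)\<^sup>2 + real n * (m / 2)))"
      \<comment> \<open>The increase by \<open>m / 2\<close> means \<eta> = -m/2, whose absolute
        value is strictly below \<open>m\<close>, as the norm estimate requires.\<close>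
      have step: "Q (?z n) - of_real (- (m / 2)) = Q (?z (Suc n))"
        using m0 by (simp add: Q_def algebra_simps add_divide_distrib)
      have "norm (Q (?z n) - of_real (- (m / 2))) \<le> m"
        by (rule norm_diff_le_of_quadratic_norm_ge[OF m0 Suc _ quartic]) (use m0 in auto)
      with min[of "?z (Suc n)"] show ?case unfolding step by simp
    qed (simp add: m_def Q_def)
    \<comment> \<open>This makes \<open>real n * (m / 2)\<close> exceed the bound that the triangle
      inequality imposes on \<open>?r\<close>.\<close>
    obtain n where n: "real n > 2 * (m + norm ((x - of_real (Re w))\<^sup>2)) / m"
      using reals_Archimedean2 by blast
    let ?r = "(Im w)\<^sup>2 + real n * (m / 2)"
    have r0: "?r \<ge> 0" using m0 by simp
    have "?r = norm (of_real ?r :: 'a)" using r0 by (simp only: norm_of_real abs_of_nonneg)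
    also have "of_real ?r = Q (Complex (Re w) (sqrt ?r)) - (x - of_real (Re w))\<^sup>2"
      using r0 by (simp add: Q_def)
    also have "norm \<dots> \<le> m + norm ((x - of_real (Re w))\<^sup>2)"
      using norm_triangle_ineq4 shift[of n] by metis
    finally have "real n * (m / 2) \<le> m + norm ((x - of_real (Re w))\<^sup>2)"
      using zero_le_power2[of "Im w"] by linarith
    with n m0 show False by (simp add: field_simps)
  qed
  then show ?thesis using that[of "Re w" "Im w"] by (simp add: m_def Q_def)
qed

text \<open>The vanishing real quadratic of \<open>x\<close> splits into linear factors over a
  square root \<open>j\<close> of -1; if there is no such root, then b = 0 and \<open>x\<close> is
  real. Bounded coordinates reduce integration to real-valued functions.\<close>

lemma real_normed_field_coordinates:
  obtains j :: "'a::real_normed_field" and re im :: "'a \<Rightarrow> real"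
  where "bounded_linear re" "bounded_linear im" "\<And>x. x = of_real (re x) + j * of_real (im x)"
proof (cases "\<exists>j::'a. j\<^sup>2 = -1")
  case False
  have "\<exists>a. x = of_real a" for x :: 'a
  proof -
    obtain a b :: real where ab: "(x - of_real a)\<^sup>2 + of_real (b\<^sup>2) = 0" by (rule real_quadratic_exists)
    have "b = 0"
    proof (rule ccontr)
      assume "b \<noteq> 0"
      then have "((x - of_real a) / of_real b)\<^sup>2 = -1"
        using ab by (simp add: power_divide field_simps eq_neg_iff_add_eq_0)
      with False show False by blast
    qed
    with ab show ?thesis by auto
  qed
  then obtain re :: "'a \<Rightarrow> real" where re: "\<And>x. x = of_real (re x)" by metis
  have "re (x + y) = re x + re y" for x y
    by (metis re of_real_add of_real_eq_iff)
  moreover have "re (r *\<^sub>R x) = r *\<^sub>R re x" for r x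
    by (metis re scaleR_conv_of_real of_real_mult of_real_eq_iff real_scaleR_def)
  moreover have "norm (re x) \<le> norm x * 1" for x
    by (metis re norm_of_real real_norm_def mult_1_right order_refl)
  ultimately have "bounded_linear re" by (rule bounded_linear_intro)
  \<comment> \<open>In the real case both \<open>j\<close> and the second coordinate are set to
    0.\<close>
  then show ?thesis using that[of re "\<lambda>_. 0" 0] re by (simp add: bounded_linear_zero)
next
  case True
  then obtain j :: 'a where j: "j\<^sup>2 = -1" by blast
  have nj: "norm j = 1"
    using arg_cong[OF j, of norm] norm_ge_zero[of j] by (simp add: norm_power power2_eq_1_iff)
  have "\<exists>a b. x = of_real a + j * of_real b" for x :: 'a
  proof -
    obtain a b :: real where "(x - of_real a)\<^sup>2 + of_real (b\<^sup>2) = 0" by (rule real_quadratic_exists)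
    moreover have "(x - (of_real a + j * of_real b)) * (x - (of_real a + j * of_real (-b)))
        = (x - of_real a)\<^sup>2 - j\<^sup>2 * of_real (b\<^sup>2)"
      by (simp add: power2_eq_square algebra_simps)
    ultimately have "(x - (of_real a + j * of_real b)) * (x - (of_real a + j * of_real (-b))) = 0"
      by (simp add: j)
    then show ?thesis by (metis mult_eq_0_iff right_minus_eq)
  qed
  then obtain re im where ri: "\<And>x. x = of_real (re x) + j * of_real (im x)" by metis
  \<comment> \<open>Multiplying by the conjugate, whose norm is at most \<bar>a\<bar> +
    \<bar>b\<bar>, gives a^2 + b^2, which is at least half the square of \<bar>a\<bar> +
    \<bar>b\<bar>. The bound yields both uniqueness and boundedness of the coordinates.\<close>
  have bound: "\<bar>a\<bar> + \<bar>b\<bar> \<le> 2 * norm (of_real a + j * of_real b)" for a b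
  proof (cases "a = 0 \<and> b = 0")
    case False
    define s where "s = \<bar>a\<bar> + \<bar>b\<bar>"
    have s: "s > 0" using False by (auto simp: s_def)
    have "s\<^sup>2 \<le> 2 * (a\<^sup>2 + b\<^sup>2)"
      using zero_le_power2[of "\<bar>a\<bar> - \<bar>b\<bar>"] by (simp add: s_def power2_sum power2_diff)
    also have "a\<^sup>2 + b\<^sup>2 = norm (of_real (a\<^sup>2 + b\<^sup>2) :: 'a)" by (simp only: norm_of_real) simp
    also have "of_real (a\<^sup>2 + b\<^sup>2) = (of_real a + j * of_real b) * (of_real a - j * of_real b)"
      by (simp add: square_diff_square_factored[symmetric] power_mult_distrib j flip: power2_eq_square)
    also have "norm \<dots> \<le> norm (of_real a + j * of_real b) * s"
      unfolding norm_mult s_def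
      using norm_triangle_ineq4[of "of_real a" "j * of_real b"] nj
      by (intro mult_left_mono) (auto simp: norm_mult)
    finally show ?thesis using s by (simp add: power2_eq_square s_def)
  qed simp
  have uniq: "re x = a \<and> im x = b" if "x = of_real a + j * of_real b" for x a b
  proof -
    have "of_real (re x - a) + j * of_real (im x - b) = 0"
      using that ri[of x] by (simp add: algebra_simps)
    with bound[of "re x - a" "im x - b"] show ?thesis by (auto simp del: of_real_diff)
  qed
  have add: "re (x + y) = re x + re y \<and> im (x + y) = im x + im y" for x y
  proof (rule uniq)
    show "x + y = of_real (re x + re y) + j * of_real (im x + im y)"
      by (subst (1) ri[of x], subst (1) ri[of y]) (simp add: algebra_simps)
  qed
  have scale: "re (r *\<^sub>R x) = r *\<^sub>R re x \<and> im (r *\<^sub>R x) = r *\<^sub>R im x" for r x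
  proof (rule uniq)
    show "r *\<^sub>R x = of_real (r *\<^sub>R re x) + j * of_real (r *\<^sub>R im x)"
      by (subst (1) ri[of x]) (simp add: algebra_simps scaleR_conv_of_real)
  qed
  have "norm (re x) \<le> norm x * 2" "norm (im x) \<le> norm x * 2" for x
    using bound[of "re x" "im x"] ri[of x, symmetric] by auto
  then have "bounded_linear re" "bounded_linear im"
    using add scale by (auto intro: bounded_linear_intro[of re 2] bounded_linear_intro[of im 2] simp del: real_norm_def)
  then show ?thesis by (rule that) (rule ri)
qed

section \<open>Antiderivatives and one-sided derivatives\<close>

lemma antiderivative_continuous_real_normed_field:
  fixes f :: "real \<Rightarrow> 'a::real_normed_field"
  assumes "continuous_on {a..b} f"
  obtains F where "\<And>x. x \<in> {a..b} \<Longrightarrow> (F has_vector_derivative f x) (at x within {a..b})"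
proof -
  obtain j :: 'a and re im where bl: "bounded_linear re" "bounded_linear im"
    and eq: "\<And>x. x = of_real (re x) + j * of_real (im x)"
    by (rule real_normed_field_coordinates) (rule that)
  have "continuous_on {a..b} (\<lambda>t. re (f t))" "continuous_on {a..b} (\<lambda>t. im (f t))"
    using assms bl by (auto intro: bounded_linear.continuous_on)
  then obtain G H where
    G: "\<And>x. x \<in> {a..b} \<Longrightarrow> (G has_vector_derivative re (f x)) (at x within {a..b})" and
    H: "\<And>x. x \<in> {a..b} \<Longrightarrow> (H has_vector_derivative im (f x)) (at x within {a..b})"
    by (metis antiderivative_continuous)
  have "((\<lambda>t. of_real (G t) + j * of_real (H t)) has_vector_derivative f x) (at x within {a..b})"
    if "x \<in> {a..b}" for x
  proof -
    have "((\<lambda>t. of_real (G t) + j * of_real (H t)) has_vector_derivative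
        of_real (re (f x)) + j * of_real (im (f x))) (at x within {a..b})"
      using that G H
      by (intro has_vector_derivative_add has_vector_derivative_mult_right
          has_vector_derivative_of_real) (auto simp: has_real_derivative_iff_has_vector_derivative)
    then show ?thesis using eq[of "f x"] by simp
  qed
  then show ?thesis by (rule that)
qed


lemma has_vector_derivative_imp_tendsto_at_right:
  fixes f :: "real \<Rightarrow> 'a::real_normed_vector"
  assumes "(f has_vector_derivative D) (at x within {x..b})" "x < b"
  shows "((\<lambda>s. (f s - f x) /\<^sub>R (s - x)) \<longlongrightarrow> D) (at_right x)"
proof -
  have "((\<lambda>s. ((f s - f x) - (s - x) *\<^sub>R D) /\<^sub>R norm (s - x)) \<longlongrightarrow> 0) (at_right x)"
    using assms by (simp add: has_vector_derivative_def has_derivative_at_within at_within_Icc_at_right)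
  then have "((\<lambda>s. (f s - f x) /\<^sub>R (s - x) - D) \<longlongrightarrow> 0) (at_right x)"
  proof (rule Lim_transform_eventually)
    show "\<forall>\<^sub>F s in at_right x. ((f s - f x) - (s - x) *\<^sub>R D) /\<^sub>R norm (s - x) = (f s - f x) /\<^sub>R (s - x) - D"
      using eventually_at_right_less by eventually_elim (simp add: scaleR_diff_right)
  qed
  then show ?thesis by (rule LIM_zero_cancel)
qed

section \<open>Continuity and differentiability of triangular Toeplitz semigroups\<close>

text \<open>\<open>a k s\<close> is the entry on the k-th subdiagonal at time \<open>s\<close>;
  \<open>add\<close> is matrix multiplication, and the values at 0 are those of the identity
  matrix.\<close>

locale convolution_semigroup =
  fixes a :: "nat \<Rightarrow> real \<Rightarrow> 'a::real_normed_field" and d :: nat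
  assumes add: "\<And>k s u. k \<le> d \<Longrightarrow> s \<ge> 0 \<Longrightarrow> u \<ge> 0 \<Longrightarrow> a k (s + u) = (\<Sum>i\<le>k. a i s * a (k - i) u)"
    and zero: "\<And>k. k \<le> d \<Longrightarrow> a k 0 = (if k = 0 then 1 else 0)"
    and right_cont: "\<And>k. k \<le> d \<Longrightarrow> (a k \<longlongrightarrow> (if k = 0 then 1 else 0)) (at_right 0)"
begin

lemma tendsto_at_right:
  assumes k: "k \<le> d" and t: "t \<ge> 0"
  shows "(a k \<longlongrightarrow> a k t) (at_right t)"
proof -
  have "((\<lambda>u. \<Sum>i\<le>k. a i t * a (k - i) u) \<longlongrightarrow> (\<Sum>i\<le>k. a i t * a (k - i) 0)) (at_right 0)"
  proof (intro tendsto_intros)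
    fix i
    have "k - i \<le> d" using k by simp
    then show "(a (k - i) \<longlongrightarrow> a (k - i) 0) (at_right 0)"
      unfolding zero[OF \<open>k - i \<le> d\<close>] by (rule right_cont)
  qed
  then have "((\<lambda>u. \<Sum>i\<le>k. a i t * a (k - i) u) \<longlongrightarrow> a k t) (at_right 0)"
    using add[of k t 0] k t by simp
  then have "((\<lambda>u. a k (u + t)) \<longlongrightarrow> a k t) (at_right 0)"
  proof (rule Lim_transform_eventually)
    show "\<forall>\<^sub>F u in at_right 0. (\<Sum>i\<le>k. a i t * a (k - i) u) = a k (u + t)"
      using eventually_at_right_less
      by eventually_elim (use add[of k t] k t in \<open>simp add: add.commute[of _ t]\<close>)
  qed
  then show ?thesis by (simp add: filterlim_at_right_to_0[of _ _ t])
qed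

text \<open>The addition formula for t = (t - u) + u is a triangular system for the entries at t -
  u. It is solved upwards from k = 0, since \<open>a 0 u\<close> tends to 1 and is nonzero for small
  \<open>u\<close>.\<close>

lemma tendsto_at_left:
  assumes "k \<le> d" and t: "t > 0"
  shows "(a k \<longlongrightarrow> a k t) (at_left t)"
  using assms(1)
proof (induction k rule: less_induct)
  case (less k)
  have ev: "\<forall>\<^sub>F u in at_right 0. (a k t - (\<Sum>i<k. a i (t - u) * a (k - i) u)) / a 0 u = a k (t - u)"
  proof -
    have "\<forall>\<^sub>F u in at_right 0. a 0 u \<noteq> 0"
      using right_cont[of 0] by (intro tendsto_imp_eventually_ne) auto
    then show ?thesis
      using eventually_at_right_less eventually_at_right_real[OF t]
    proof eventually_elim
      case (elim u)
      have "a k t = (\<Sum>i\<le>k. a i (t - u) * a (k - i) u)"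
        using add[of k "t - u" u] less.prems elim by simp
      also have "\<dots> = (\<Sum>i<k. a i (t - u) * a (k - i) u) + a k (t - u) * a 0 u"
        by (simp add: lessThan_Suc_atMost[symmetric])
      finally show ?case using elim by simp
    qed
  qed
  have IH: "((\<lambda>u. a i (t - u)) \<longlongrightarrow> a i t) (at_right 0)" if "i < k" for i
    using less.IH[of i] that less.prems
    by (simp add: filterlim_at_left_to_right filterlim_at_right_to_0[of _ _ "-t"])
  \<comment> \<open>For i < k the factor \<open>a (k - i) u\<close> tends to 0, so the limit is
    \<open>a k t\<close>; the conditionals keep the shape of \<open>right_cont\<close>.\<close>
  have "((\<lambda>u. (a k t - (\<Sum>i<k. a i (t - u) * a (k - i) u)) / a 0 u) \<longlongrightarrow>
      (a k t - (\<Sum>i<k. a i t * (if k - i = 0 then 1 else 0))) / (if (0::nat) = 0 then 1 else 0)) (at_right 0)"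
    using less.prems right_cont[of 0] by (intro tendsto_intros IH right_cont) auto
  then have "((\<lambda>u. (a k t - (\<Sum>i<k. a i (t - u) * a (k - i) u)) / a 0 u) \<longlongrightarrow> a k t) (at_right 0)"
    by simp
  then have "((\<lambda>u. a k (t - u)) \<longlongrightarrow> a k t) (at_right 0)"
    using ev by (rule Lim_transform_eventually)
  then show ?case
    by (simp add: filterlim_at_left_to_right filterlim_at_right_to_0[of _ _ "-t"])
qed

lemma continuous_on_Icc:
  assumes "k \<le> d" "b > 0"
  shows "continuous_on {0..b} (a k)"
  unfolding continuous_on_def
proof
  fix t assume t: "t \<in> {0..b}"
  show "(a k \<longlongrightarrow> a k t) (at t within {0..b})"
  proof (cases "t = 0")
    case True
    then show ?thesis using assms tendsto_at_right[of k 0] by (simp add: at_within_Icc_at_right)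
  next
    case False
    with t have "(a k \<longlongrightarrow> a k t) (at t)"
      using assms tendsto_at_right[of k t] tendsto_at_left[of k t] by (simp add: filterlim_at_split)
    then show ?thesis by (rule tendsto_within_subset) simp
  qed
qed

(* Convolving the semigroup with its integral over [0,h] gives a difference of primitives, hence
   something differentiable; the integral of the zeroth entry is nonzero for small h, so the
   triangular system can be solved for the entries. *)
lemma differentiable_at_0:
  assumes "k \<le> d"
  shows "\<exists>D. (a k has_vector_derivative D) (at 0 within {0..1})"
proof -
  \<comment> \<open>The interval [0,2] leaves room for sums of two times in [0,1].\<close>
  have "\<exists>F. \<forall>t\<in>{0..2}. (F has_vector_derivative a k t) (at t within {0..2})" if "k \<le> d" for k
    using antiderivative_continuous_real_normed_field[OF continuous_on_Icc[OF that, of 2]]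
    by (metis zero_less_numeral)
  then obtain F where F: "\<And>k t. k \<le> d \<Longrightarrow> t \<in> {0..2} \<Longrightarrow> (F k has_vector_derivative a k t) (at t within {0..2})"
    by metis
  \<comment> \<open>Otherwise the right derivative of \<open>F 0\<close> at 0 would be 0, whereas it
    is \<open>a 0 0\<close>, which is 1.\<close>
  have "\<exists>h. 0 < h \<and> h \<le> 1 \<and> F 0 h \<noteq> F 0 0"
  proof (rule ccontr)
    assume "\<nexists>h. 0 < h \<and> h \<le> 1 \<and> F 0 h \<noteq> F 0 0"
    then have eq: "F 0 h = F 0 0" if "0 < h" "h \<le> 1" for h using that by blast
    have "((\<lambda>s. (F 0 s - F 0 0) /\<^sub>R (s - 0)) \<longlongrightarrow> a 0 0) (at_right 0)"
      by (rule has_vector_derivative_imp_tendsto_at_right[where b=2]) (use F[of 0 0] in auto)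
    moreover have "((\<lambda>s. (F 0 s - F 0 0) /\<^sub>R (s - 0)) \<longlongrightarrow> 0) (at_right 0)"
    proof (rule Lim_transform_eventually[OF tendsto_const])
      show "\<forall>\<^sub>F s in at_right 0. 0 = (F 0 s - F 0 0) /\<^sub>R (s - 0)"
        using eventually_at_right_real[OF zero_less_one] by eventually_elim (use eq in force)
    qed
    ultimately have "a 0 0 = 0" by (metis tendsto_unique trivial_limit_at_right_real)
    then show False using zero[of 0] by simp
  qed
  then obtain h where h: "0 < h" "h \<le> 1" "F 0 h \<noteq> F 0 0" by blast
  define V where "V i = F i h - F i 0" for i
  have conv: "(\<Sum>i\<le>k. V i * a (k - i) t) = F k (t + h) - F k t" if k: "k \<le> d" and t: "t \<in> {0..1}" for k t
  proof -
    \<comment> \<open>By the addition formula \<open>G\<close> has derivative 0 in \<open>u\<close>;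
      the claim compares its values at \<open>h\<close> and 0.\<close>
    define G where "G u = (\<Sum>i\<le>k. F i u * a (k - i) t) - F k (t + u)" for u
    have "(G has_vector_derivative 0) (at u within {0..1})" if u: "u \<in> {0..1}" for u
    proof -
      have shift: "((\<lambda>u. t + u) has_vector_derivative 1) (at u within {0..1})"
        by (auto intro!: derivative_eq_intros)
      have img: "(\<lambda>u. t + u) ` {0..1} \<subseteq> {0..2}" using t by auto
      have "((F k \<circ> (\<lambda>u. t + u)) has_vector_derivative 1 *\<^sub>R a k (t + u)) (at u within {0..1})"
        by (rule vector_diff_chain_within[OF shift has_vector_derivative_within_subset[OF F img]])
          (use k t u in auto)
      then have 1: "((\<lambda>u. F k (t + u)) has_vector_derivative a k (t + u)) (at u within {0..1})"
        by (simp add: o_def)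
      have 2: "(F i has_vector_derivative a i u) (at u within {0..1})" if "i \<le> k" for i
        by (rule has_vector_derivative_within_subset[OF F]) (use that k u in auto)
      have "(G has_vector_derivative (\<Sum>i\<le>k. a i u * a (k - i) t) - a k (t + u)) (at u within {0..1})"
        unfolding G_def using 2
        by (intro has_vector_derivative_diff has_vector_derivative_sum has_vector_derivative_mult_left 1) auto
      then show ?thesis using add[of k u t] k t u by (simp add: add.commute)
    qed
    then obtain c where "\<And>u. u \<in> {0..1} \<Longrightarrow> G u = c"
      using has_vector_derivative_zero_constant[of "{0..1}" G] convex_real_interval by metis
    then have "G h = G 0" using h by simp
    then show ?thesis by (simp add: G_def V_def algebra_simps sum_subtractf)
  qed
  show ?thesis
    using assms
  proof (induction k rule: less_induct)
    case (less k)
    \<comment> \<open>The index 0 is left out because its term carries the unknown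
      \<open>a k\<close>; all other terms fall under the induction hypothesis.\<close>
    have "\<exists>D. \<forall>i\<in>{1..k}. (a (k - i) has_vector_derivative D i) (at 0 within {0..1})"
      using less.IH less.prems by (intro bchoice) auto
    then obtain D where D: "\<And>i. i \<in> {1..k} \<Longrightarrow> (a (k - i) has_vector_derivative D i) (at 0 within {0..1})"
      by blast
    have shift: "((\<lambda>t. t + h) has_vector_derivative 1) (at 0 within {0..1})"
      by (auto intro!: derivative_eq_intros)
    have img: "(\<lambda>t. t + h) ` {0..1} \<subseteq> {0..2}" using h by auto
    have "((F k \<circ> (\<lambda>t. t + h)) has_vector_derivative 1 *\<^sub>R a k (0 + h)) (at 0 within {0..1})"
      by (rule vector_diff_chain_within[OF shift has_vector_derivative_within_subset[OF F img]])
        (use less.prems h in auto)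
    then have 1: "((\<lambda>t. F k (t + h)) has_vector_derivative a k h) (at 0 within {0..1})"
      by (simp add: o_def)
    have 2: "(F k has_vector_derivative a k 0) (at 0 within {0..1})"
      by (rule has_vector_derivative_within_subset[OF F]) (use less.prems in auto)
    \<comment> \<open>This is \<open>conv\<close> solved for \<open>a k t\<close>;
      \<open>V 0\<close> is nonzero by the choice of \<open>h\<close>.\<close>
    let ?f = "\<lambda>t. (F k (t + h) - F k t - (\<Sum>i=1..k. V i * a (k - i) t)) / V 0"
    have "(?f has_vector_derivative (a k h - a k 0 - (\<Sum>i=1..k. V i * D i)) / V 0) (at 0 within {0..1})"
      by (intro has_vector_derivative_divide has_vector_derivative_diff has_vector_derivative_sum
          has_vector_derivative_mult_right 1 2 D)
    moreover have "?f t = a k t" if "t \<in> {0..1}" for t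
    proof -
      have "F k (t + h) - F k t = V 0 * a k t + (\<Sum>i=1..k. V i * a (k - i) t)"
        unfolding conv[OF less.prems that, symmetric]
        by (simp add: atMost_atLeast0 sum.atLeast_Suc_atMost)
      then show ?thesis using h by (simp add: V_def)
    qed
    ultimately show ?case
      by (metis (no_types, lifting) has_vector_derivative_transform atLeastAtMost_iff zero_le_one order_refl)
  qed
qed

end

section \<open>The coefficient map and the two convolutions\<close>

lemma falling_nonzero:
  assumes "n \<le> d"
  shows "falling d n \<noteq> (0 :: 'a::{idom, ring_char_0})"
  using assms by (auto simp: falling_def)

lemma coeff_sum_monom_top:
  assumes "n \<le> d"
  shows "coeff (\<Sum>k\<le>d. monom (c k) (d - k)) (d - n) = c n"
proof -
  have "coeff (\<Sum>k\<le>d. monom (c k) (d - k)) (d - n) = (\<Sum>k\<le>d. if k = n then c k else 0)"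
    unfolding coeff_sum using assms by (intro sum.cong) auto
  then show ?thesis using assms by simp
qed

lemma coeff_sum_monom_gt:
  assumes "n > d"
  shows "coeff (\<Sum>k\<le>d. monom (c k) (d - k)) n = 0"
  using assms by (auto simp: coeff_sum intro!: sum.neutral)

text \<open>Every coefficient of \<open>free_conv\<close> is read off from this form: the
  top-indexed ones are values of \<open>H_conv\<close>, and those above degree \<open>d\<close>
  vanish.\<close>

lemma free_conv_eq_sum_monom:
  "free_conv d p q = (\<Sum>k\<le>d. monom (H_conv d (J_map d p) (J_map d q) k) (d - k))"
  unfolding free_conv_def H_conv_def J_map_def
  by (intro sum.cong refl) (auto simp: monom_sum intro!: sum.cong)

lemma J_map_free_conv: "J_map d (free_conv d p q) = H_conv d (J_map d p) (J_map d q)"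
proof
  fix n
  have "J_map d (free_conv d p q) n = (if n \<le> d then H_conv d (J_map d p) (J_map d q) n else 0)"
    unfolding J_map_def[of d "free_conv d p q"]
    by (simp add: top_coeff_def free_conv_eq_sum_monom coeff_sum_monom_top)
  then show "J_map d (free_conv d p q) n = H_conv d (J_map d p) (J_map d q) n"
    by (simp add: H_conv_def)
qed

section \<open>Existence and intertwining of the generators\<close>

theorem theorem5p6:
  fixes d :: nat
    and q :: "real \<Rightarrow> 'a::real_normed_field poly"
    and p :: "'a poly"
  assumes "d \<ge> 1"
    and "\<And>s. s \<ge> 0 \<Longrightarrow> q s \<in> polys_le d"
    and "q 0 = monom 1 d"
    and "\<And>s u. s \<ge> 0 \<Longrightarrow> u \<ge> 0 \<Longrightarrow> q (s + u) = free_conv d (q s) (q u)"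
    and "poly_tendsto q (monom 1 d) (at_right 0)"
    and "p \<in> polys_le d"
  shows "poly_tendsto (free_quot d q p) (free_generator d q p) (at_right 0)
    \<and> free_generator d q p \<in> polys_le d
    \<and> map_tendsto (H_quot d (\<lambda>s. J_map d (q s)) (J_map d p))
        (H_generator d (\<lambda>s. J_map d (q s)) (J_map d p)) (at_right 0)
    \<and> H_generator d (\<lambda>s. J_map d (q s)) (J_map d p) \<in> maps_le d
    \<and> J_map d (free_generator d q p) = H_generator d (\<lambda>s. J_map d (q s)) (J_map d p)"
proof -
  define a :: "nat \<Rightarrow> real \<Rightarrow> 'a" where "a k s = J_map d (q s) k / falling d k" for k s
  have fall0: "falling d 0 = (1::'a)" by (simp add: falling_def)
  have one: "coeff (monom 1 d) (d - k) = (if k = 0 then 1 else (0::'a))" if "k \<le> d" for k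
    using that \<open>d \<ge> 1\<close> by auto
  interpret convolution_semigroup a d
  proof
    fix k and s u :: real assume k: "k \<le> d" and "s \<ge> 0" "u \<ge> 0"
    then have "a k (s + u) = H_conv d (J_map d (q s)) (J_map d (q u)) k / falling d k"
      using assms(4) by (simp add: a_def J_map_free_conv)
    also have "\<dots> = (\<Sum>i\<le>k. a i s * a (k - i) u)"
      using k falling_nonzero[OF k, where 'a='a]
      by (simp add: H_conv_def a_def sum_divide_distrib)
    finally show "a k (s + u) = (\<Sum>i\<le>k. a i s * a (k - i) u)" .
  next
    fix k assume "k \<le> d"
    then show "a k 0 = (if k = 0 then 1 else 0)"
      using assms(3) one fall0 by (simp add: a_def J_map_def top_coeff_def)
  next
    fix k assume k: "k \<le> d"
    have "((\<lambda>s. coeff (q s) (d - k) / falling d k) \<longlongrightarrow> coeff (monom 1 d) (d - k) / falling d k) (at_right 0)"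
      using assms(5) falling_nonzero[OF k, where 'a='a]
      unfolding poly_tendsto_def by (intro tendsto_intros) auto
    then show "(a k \<longlongrightarrow> (if k = 0 then 1 else 0)) (at_right 0)"
      using k one[OF k] fall0 by (simp add: a_def[abs_def] J_map_def top_coeff_def split: if_splits)
  qed
  have "\<exists>D. \<forall>k\<in>{..d}. (a k has_vector_derivative D k) (at 0 within {0..1})"
    using differentiable_at_0 by (intro bchoice) auto
  then obtain D where D: "\<And>k. k \<le> d \<Longrightarrow> (a k has_vector_derivative D k) (at 0 within {0..1})"
    by auto
  define g where "g = J_map d p"
  \<comment> \<open>\<open>l\<close> is the derivative at time 0 of the convolution of
    \<open>g\<close> with the semigroup. The factor \<open>falling d (n - i)\<close> is absorbed in
    \<open>D\<close>, which differentiates normalised coefficients.\<close>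
  define l where "l n = (if n \<le> d then \<Sum>i\<le>n. falling d n / falling d i * g i * D (n - i) else 0)" for n
  have conv: "H_conv d g (J_map d (q s)) n = (\<Sum>i\<le>n. falling d n / falling d i * g i * a (n - i) s)"
    if "n \<le> d" for n s
    using that by (simp add: H_conv_def a_def)
  have Hlim: "map_tendsto (H_quot d (\<lambda>s. J_map d (q s)) g) l (at_right 0)"
    unfolding map_tendsto_def
  proof
    fix n
    show "((\<lambda>s. H_quot d (\<lambda>s. J_map d (q s)) g s n) \<longlongrightarrow> l n) (at_right 0)"
    proof (cases "n \<le> d")
      case False
      then show ?thesis by (simp add: H_quot_def H_conv_def g_def J_map_def l_def)
    next
      case n: True
      define f where "f s = H_conv d g (J_map d (q s)) n" for s
      have "(f has_vector_derivative l n) (at 0 within {0..1})"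
        unfolding f_def conv[OF n] l_def using n
        by (simp only: if_True) (intro has_vector_derivative_sum has_vector_derivative_mult_right D, auto)
      then have "((\<lambda>s. (f s - f 0) /\<^sub>R (s - 0)) \<longlongrightarrow> l n) (at_right 0)"
        by (rule has_vector_derivative_imp_tendsto_at_right) simp
      \<comment> \<open>At time 0 the semigroup is the unit of the convolution, so only the term i =
        n survives.\<close>
      moreover have "f 0 = g n"
      proof -
        have "f 0 = (\<Sum>i\<le>n. if i = n then g i else 0)"
          unfolding f_def conv[OF n]
          using n falling_nonzero[OF n, where 'a='a] zero by (intro sum.cong) auto
        then show ?thesis by simp
      qed
      ultimately show ?thesis
        by (simp add: f_def H_quot_def scaleR_conv_of_real divide_inverse mult.commute)
    qed
  qed
  then have Hgen: "H_generator d (\<lambda>s. J_map d (q s)) g = l" by (rule H_generator_eqI)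
  \<comment> \<open>The preimage of \<open>l\<close> under the coefficient map is the candidate
    limit for polynomials.\<close>
  define L where "L = (\<Sum>k\<le>d. monom (l k) (d - k))"
  have JL: "J_map d L = l"
    by (rule ext) (simp add: J_map_def top_coeff_def L_def coeff_sum_monom_top l_def)
  \<comment> \<open>The coefficient map commutes with forming the difference quotient at each fixed
    \<open>s\<close>, so \<open>Hlim\<close> carries over coefficientwise.\<close>
  have quot: "coeff (free_quot d q p s) (d - k) = H_quot d (\<lambda>s. J_map d (q s)) g s k" if "k \<le> d" for k s
    using that fun_cong[OF J_map_free_conv[of d p "q s"], of k]
    by (simp add: free_quot_def H_quot_def g_def J_map_def top_coeff_def)
  have flim: "poly_tendsto (free_quot d q p) L (at_right 0)"
    unfolding poly_tendsto_def
  proof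
    fix n
    show "((\<lambda>s. coeff (free_quot d q p s) n) \<longlongrightarrow> coeff L n) (at_right 0)"
    proof (cases "n \<le> d")
      case True
      then show ?thesis
        using Hlim quot[of "d - n"] coeff_sum_monom_top[of "d - n" d l]
        by (simp add: map_tendsto_def L_def)
    next
      \<comment> \<open>Above degree \<open>d\<close> the quotients and \<open>L\<close> all have
        coefficient 0; for \<open>p\<close> itself this is the degree bound.\<close>
      case False
      then have "coeff p n = 0" using assms(6) by (simp add: polys_le_def coeff_eq_0)
      with False show ?thesis
        by (simp add: free_quot_def free_conv_eq_sum_monom L_def coeff_sum_monom_gt)
    qed
  qed
  then have fgen: "free_generator d q p = L" by (rule free_generator_eqI)
  have "L \<in> polys_le d"
    by (auto simp: polys_le_def L_def intro!: degree_le coeff_sum_monom_gt)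
  moreover have "l \<in> maps_le d" by (simp add: maps_le_def l_def)
  ultimately show ?thesis
    using Hlim flim JL unfolding Hgen[unfolded g_def] fgen g_def by simp
qed

end
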